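(* Let $G$ be a transitive permutation group of degree $d$ which can be generated by $k$ elements. Then there exist an alphabet $A$ with $k$ letters and a finite bifix code $X\subset A^+$ with $\mathrm{Card}(X)=(k-1)d+1$ such that $G$ is (equivalent, as a permutation group, to) a syntactic group of $X$.
   Context: A bifix code is a set of nonempty words none of which is a proper prefix or proper suffix of another. The minimal automaton of a set $L\subset A^*$ has as states the nonempty sets $u^{-1}L=\{v\mid uv\in L\}$, initial state $L$, and transitions $u^{-1}L\cdot a=(ua)^{-1}L$ (undefined if empty); each word $w$ induces a partial map $q\mapsto q\cdot w$ on states, and these maps form the transition monoid. A group in a monoid $M$ is a subsemigroup isomorphic to a group; it is maximal if not contained in another group in $M$. In a monoid of partial maps, all elements of such a group have a common image $I$ and their restrictions to $I$ are permutations, giving a faithful permutation representation on $I$ (the canonical representation). A syntactic group of a prefix code $X$ is the canonical representation of a maximal group in the transition monoid of the minimal automaton of $X^*$. Two permutation groups $G$ on $R$ and $H$ on $S$ are equivalent if there is a bijection $\beta:R\to S$ and an isomorphism $\sigma:G\to H$ with $\beta(rg)=\beta(r)\sigma(g)$ for all $r,g$. The degree of a permutation group is the size of the set it acts on; it is transitive if any point can be mapped to any other. *)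

theory Defs
  imports Main "HOL-Library.Sublist" "HOL-Combinatorics.Permutations"
begin

definition bifix_code :: "'a list set \<Rightarrow> bool" where
  "bifix_code X \<longleftrightarrow> [] \<notin> X \<and>
     (\<forall>x\<in>X. \<forall>y\<in>X. \<not> strict_prefix x y \<and> \<not> strict_suffix x y)"

definition star :: "'a list set \<Rightarrow> 'a list set" where
  "star X = {concat ws | ws. set ws \<subseteq> X}"

definition lquot :: "'a list \<Rightarrow> 'a list set \<Rightarrow> 'a list set" where
  "lquot u L = {v. u @ v \<in> L}"

definition min_states :: "'a set \<Rightarrow> 'a list set \<Rightarrow> 'a list set set" where
  "min_states A L = {lquot u L | u. u \<in> lists A \<and> lquot u L \<noteq> {}}"

definition trans_map :: "'a set \<Rightarrow> 'a list set \<Rightarrow> 'a list \<Rightarrow> ('a list set \<Rightarrow> 'a list set option)" where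
  "trans_map A L w = (\<lambda>q. if q \<in> min_states A L \<and> lquot w q \<noteq> {} then Some (lquot w q) else None)"

definition trans_monoid :: "'a set \<Rightarrow> 'a list set \<Rightarrow> ('a list set \<Rightarrow> 'a list set option) set" where
  "trans_monoid A L = {trans_map A L w | w. w \<in> lists A}"

definition pmult :: "('q \<Rightarrow> 'q option) \<Rightarrow> ('q \<Rightarrow> 'q option) \<Rightarrow> ('q \<Rightarrow> 'q option)" where
  "pmult f g = g \<circ>\<^sub>m f"

definition group_in :: "('q \<Rightarrow> 'q option) set \<Rightarrow> ('q \<Rightarrow> 'q option) set \<Rightarrow> bool" where
  "group_in M H \<longleftrightarrow> H \<subseteq> M \<and> (\<forall>x\<in>H. \<forall>y\<in>H. pmult x y \<in> H) \<and>
     (\<exists>e\<in>H. (\<forall>h\<in>H. pmult e h = h \<and> pmult h e = h) \<and>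
            (\<forall>h\<in>H. \<exists>h'\<in>H. pmult h h' = e \<and> pmult h' h = e))"

definition max_group_in :: "('q \<Rightarrow> 'q option) set \<Rightarrow> ('q \<Rightarrow> 'q option) set \<Rightarrow> bool" where
  "max_group_in M H \<longleftrightarrow> group_in M H \<and> (\<forall>H'. group_in M H' \<and> H \<subseteq> H' \<longrightarrow> H' = H)"

text \<open>Canonical representation: common image I, restrictions to I (identity outside I).\<close>
definition canon_dom :: "('q \<Rightarrow> 'q option) set \<Rightarrow> 'q set" where
  "canon_dom H = (\<Union>h\<in>H. ran h)"

definition canon_perms :: "('q \<Rightarrow> 'q option) set \<Rightarrow> ('q \<Rightarrow> 'q) set" where
  "canon_perms H = (\<lambda>h q. if q \<in> canon_dom H then the (h q) else q) ` H"

definition syntactic_group :: "'a set \<Rightarrow> 'a list set \<Rightarrow> 'a list set set \<Rightarrow> ('a list set \<Rightarrow> 'a list set) set \<Rightarrow> bool" where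
  "syntactic_group A X I P \<longleftrightarrow>
     (\<exists>H. max_group_in (trans_monoid A (star X)) H \<and> I = canon_dom H \<and> P = canon_perms H)"

definition perm_group :: "'r set \<Rightarrow> ('r \<Rightarrow> 'r) set \<Rightarrow> bool" where
  "perm_group R G \<longleftrightarrow> (\<forall>g\<in>G. g permutes R) \<and> id \<in> G \<and>
     (\<forall>g\<in>G. \<forall>h\<in>G. g \<circ> h \<in> G) \<and> (\<forall>g\<in>G. inv g \<in> G)"

definition transitive_on :: "'r set \<Rightarrow> ('r \<Rightarrow> 'r) set \<Rightarrow> bool" where
  "transitive_on R G \<longleftrightarrow> (\<forall>r\<in>R. \<forall>s\<in>R. \<exists>g\<in>G. g r = s)"

inductive_set perm_gen :: "('r \<Rightarrow> 'r) set \<Rightarrow> ('r \<Rightarrow> 'r) set" for S where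
  gen_id: "id \<in> perm_gen S"
| gen_base: "g \<in> S \<Longrightarrow> g \<in> perm_gen S"
| gen_comp: "g \<in> perm_gen S \<Longrightarrow> h \<in> perm_gen S \<Longrightarrow> g \<circ> h \<in> perm_gen S"
| gen_inv: "g \<in> perm_gen S \<Longrightarrow> inv g \<in> perm_gen S"

definition perm_equiv :: "'r set \<Rightarrow> ('r \<Rightarrow> 'r) set \<Rightarrow> 's set \<Rightarrow> ('s \<Rightarrow> 's) set \<Rightarrow> bool" where
  "perm_equiv R G S P \<longleftrightarrow> (\<exists>\<beta> \<sigma>. bij_betw \<beta> R S \<and> bij_betw \<sigma> G P \<and>
     (\<forall>g\<in>G. \<forall>h\<in>G. \<sigma> (g \<circ> h) = \<sigma> g \<circ> \<sigma> h) \<and>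
     (\<forall>g\<in>G. \<forall>r\<in>R. \<beta> (g r) = \<sigma> g (\<beta> r)))"

end

theory Submission
  imports Defs "HOL-Combinatorics.Cycles"
begin

text \<open>
  Let the letters of \<open>A\<close> act on \<open>R\<close> by the given generators and fix a point \<open>r0\<close>. The words
  returning to \<open>r0\<close> for the first time form a (usually infinite) bifix code, so every set of such
  words is bifix. The finite code \<open>X\<close> consists of those that are factors of an episturmian language,
  generated by a central word \<open>s\<close> and return words \<open>u b\<close>, one for each letter \<open>b\<close>.
  In this language a word that does not end in \<open>s\<close> has several right extensions only if it is a
  suffix of \<open>s\<close>, and then all letters extend it. If \<open>s\<close> read from any point of \<open>R\<close> passes through
  \<open>r0\<close>, then following \<open>s\<close> backwards from \<open>r\<close> to \<open>r0\<close> gives exactly one branching node of the prefix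
  tree of \<open>X\<close> for each \<open>r \<in> R\<close>. Counting leaves yields \<open>(k - 1) d + 1\<close> words.

  In the minimal automaton of \<open>X\<^sup>*\<close>, every state that survives reading \<open>s\<close> is sent to one of
  the \<open>d\<close> states of these nodes, and products of the words \<open>u b\<close> permute those states as the
  generators permute \<open>R\<close>. A product that ends in \<open>s\<close> and acts trivially on \<open>R\<close> is an idempotent
  whose maximal group is therefore \<open>G\<close>.
\<close>

section \<open>Episturmian languages\<close>

text \<open>
  The pairs \<open>(s, u)\<close> of the Arnoux-Rauzy construction: \<open>s\<close> is bispecial, and reading \<open>u b\<close> after
  an occurrence of \<open>s\<close> leads to the next occurrence of \<open>s\<close>.
\<close>
inductive standard_pair :: "'a set \<Rightarrow> 'a list \<Rightarrow> ('a \<Rightarrow> 'a list) \<Rightarrow> bool" for A where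
  base: "standard_pair A [] (\<lambda>b. [b])"
| step: "standard_pair A s u \<Longrightarrow> a \<in> A \<Longrightarrow>
    standard_pair A (s @ u a) (\<lambda>b. if b = a then u a else u b @ u a)"

text \<open>A set of finite words in place of the factors of one infinite word: after
  \<open>s\<close> the blocks \<open>u b\<close> may follow in any order. For the base pair these
  are all words over \<open>A\<close>; a step of the construction can only shrink the set.\<close>

definition factors :: "'a set \<Rightarrow> 'a list \<Rightarrow> ('a \<Rightarrow> 'a list) \<Rightarrow> 'a list set" where
  "factors A s u = {f. \<exists>z\<in>lists A. sublist f (s @ concat (map u z))}"

lemma standard_pair_hd: "standard_pair A s u \<Longrightarrow> \<exists>v. u b = b # v"
proof (induction arbitrary: b rule: standard_pair.induct)
  case (step s u a)
  then show ?case by (metis append_Cons)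
qed simp

lemma standard_pair_lists:
  "standard_pair A s u \<Longrightarrow> s \<in> lists A \<and> (\<forall>b\<in>A. u b \<in> lists A)"
  by (induction rule: standard_pair.induct) auto

lemma standard_pair_suffix1: "standard_pair A s u \<Longrightarrow> suffix s (s @ u b)"
proof (induction arbitrary: b rule: standard_pair.induct)
  case (step s u a)
  obtain t t' where t: "s @ u a = t @ s" "s @ u b = t' @ s"
    using step.IH[of a] step.IH[of b] by (auto simp: suffix_def)
  have "(s @ u a) @ u a = t @ s @ u a" using t(1) by simp
  moreover have "(s @ u a) @ u b @ u a = t @ (s @ u b) @ u a" using t(1) by simp
  then have "(s @ u a) @ u b @ u a = (t @ t') @ s @ u a" using t(2) by simp
  ultimately have "suffix (s @ u a) ((s @ u a) @ u a)" "suffix (s @ u a) ((s @ u a) @ u b @ u a)"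
    by (metis suffixI)+
  then show ?case by simp
qed simp

lemma standard_pair_suffix:
  assumes "standard_pair A s u"
  shows "suffix s (s @ concat (map u z))"
proof (induction z rule: rev_induct)
  case (snoc c z)
  then obtain t where "s @ concat (map u z) = t @ s" by (auto simp: suffix_def)
  then have "s @ concat (map u (z @ [c])) = t @ s @ u c" by simp
  then show ?case using standard_pair_suffix1[OF assms, of c]
    by (metis suffix_append suffix_def)
qed simp

section \<open>Recoding one construction step by a morphism\<close>

definition pad :: "'a \<Rightarrow> 'a list \<Rightarrow> 'a list" where
  "pad a z = concat (map (\<lambda>b. if b = a then [a] else [b, a]) z)"

lemma pad_simps [simp]:
  "pad a [] = []" "pad a (b # z) = (if b = a then a # pad a z else b # a # pad a z)"
  by (simp_all add: pad_def)

lemma pad_lists: "a \<in> A \<Longrightarrow> z \<in> lists A \<Longrightarrow> pad a z \<in> lists A"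
  by (induction z) auto

text \<open>The new blocks spell old blocks along \<open>pad a\<close>. With the extra
  \<open>u a\<close> in the new central word, words of the new stage are old ones coded by
  \<open>a # pad a z\<close>, where each letter other than \<open>a\<close> stands between two
  copies of \<open>a\<close>.\<close>

lemma concat_map_pad:
  "concat (map (\<lambda>b. if b = a then u a else u b @ u a) z) = concat (map u (pad a z))"
  by (induction z) auto

text \<open>Each letter image under \<open>pad a\<close> contains \<open>a\<close> exactly once, at
  its end, so a cut just after an \<open>a\<close> never splits an image.\<close>

lemma pad_split:
  "a # pad a z = w @ a # w' \<Longrightarrow> \<exists>z1 z2. z = z1 @ z2 \<and> w @ [a] = a # pad a z1"
proof (induction z arbitrary: w)
  case Nil
  then show ?case by (cases w) auto
next
  case (Cons c z)
  show ?case
  proof (cases w)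
    case Nil
    then show ?thesis by (intro exI[of _ "[]"] exI[of _ "c # z"]) simp
  next
    case (Cons x w1)
    with Cons.prems have eq: "x = a" "w1 @ a # w' = pad a (c # z)" by auto
    show ?thesis
    proof (cases "c = a")
      case True
      with eq have "a # pad a z = w1 @ a # w'" by simp
      from Cons.IH[OF this] obtain z1 z2 where "z = z1 @ z2" "w1 @ [a] = a # pad a z1" by blast
      then show ?thesis using Cons eq True by (intro exI[of _ "c # z1"] exI[of _ z2]) auto
    next
      case False
      with eq obtain w2 where w2: "w1 = c # w2" "a # pad a z = w2 @ a # w'"
        by (cases w1) auto
      from Cons.IH[OF w2(2)] obtain z1 z2 where "z = z1 @ z2" "w2 @ [a] = a # pad a z1" by blast
      then show ?thesis using Cons eq False w2
        by (intro exI[of _ "c # z1"] exI[of _ z2]) auto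
    qed
  qed
qed

text \<open>A letter other than \<open>a\<close> can only begin an image, so what precedes it is
  again a padded word.\<close>

lemma pad_before_other:
  "a # pad a z = w @ b # w' \<Longrightarrow> b \<noteq> a \<Longrightarrow> \<exists>z1. set z1 \<subseteq> set z \<and> w = a # pad a z1"
proof (induction z arbitrary: w)
  case Nil
  then show ?case by (cases w) auto
next
  case (Cons c z)
  from Cons.prems obtain w1 where w1: "w = a # w1" "pad a (c # z) = w1 @ b # w'"
    by (cases w) auto
  show ?case
  proof (cases "c = a")
    case True
    with w1 have "a # pad a z = w1 @ b # w'" by simp
    from Cons.IH[OF this Cons.prems(2)] obtain z1 where "set z1 \<subseteq> set z" "w1 = a # pad a z1" by blast
    then show ?thesis using w1 True by (intro exI[of _ "c # z1"]) auto
  next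
    case False
    show ?thesis
    proof (cases w1)
      case Nil
      then show ?thesis using w1 by (intro exI[of _ "[]"]) auto
    next
      case (Cons x w2)
      with w1 False have x: "x = c" "a # pad a z = w2 @ b # w'" by auto
      from Cons.IH[OF x(2) Cons.prems(2)] obtain z1 where
        "set z1 \<subseteq> set z" "w2 = a # pad a z1" by blast
      then show ?thesis using w1 x Cons False by (intro exI[of _ "c # z1"]) auto
    qed
  qed
qed

text \<open>An occurrence of \<open>s @ u a\<close> starts with one of \<open>s\<close>, which by
  induction ends at an old block boundary. Blocks start with distinct letters, so the next old block
  is \<open>u a\<close>, and \<open>pad_split\<close> turns its end into a boundary of new
  blocks.\<close>

lemma standard_pair_sync:
  "standard_pair A s u \<Longrightarrow> s @ concat (map u z) = x @ s @ y \<Longrightarrow>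
    \<exists>z1 z2. z = z1 @ z2 \<and> x @ s = s @ concat (map u z1)"
proof (induction arbitrary: x y z rule: standard_pair.induct)
  case base
  then show ?case by (auto simp: concat_map_singleton)
next
  case (step s u a)
  from step.prems have "s @ concat (map u (a # pad a z)) = x @ s @ u a @ y"
    by (simp add: concat_map_pad)
  from step.IH[OF this] obtain z1 z2 where
    z: "a # pad a z = z1 @ z2" "x @ s = s @ concat (map u z1)" by blast
  have "s @ concat (map u z1) @ concat (map u z2) = x @ s @ u a @ y"
    using \<open>s @ concat (map u (a # pad a z)) = x @ s @ u a @ y\<close> z(1) by simp
  then have "concat (map u z2) = u a @ y"
    using z(2) by (metis append.assoc same_append_eq)
  then obtain c z3 where z2: "z2 = c # z3" "u c @ concat (map u z3) = u a @ y"
    using standard_pair_hd[OF step.hyps(1), of a] by (cases z2) auto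
  with standard_pair_hd[OF step.hyps(1), of a] standard_pair_hd[OF step.hyps(1), of c]
  have "c = a" by auto
  with z z2 have "a # pad a z = z1 @ a # z3" by simp
  from pad_split[OF this] obtain y1 y2 where y: "z = y1 @ y2" "z1 @ [a] = a # pad a y1" by blast
  have "x @ s @ u a = s @ concat (map u (z1 @ [a]))" using z(2) by simp
  also have "\<dots> = (s @ u a) @ concat (map u (pad a y1))" using y(2) by simp
  finally show ?case using y(1) by (auto simp: concat_map_pad)
qed

text \<open>By induction the remaining case is that \<open>p\<close> ends in the old
  \<open>s\<close>. At least one of the two extending letters differs from the letter
  \<open>a\<close> of the step, and that one decides.\<close>

lemma standard_pair_right_special:
  "standard_pair A s u \<Longrightarrow> p @ [b] \<in> factors A s u \<Longrightarrow> p @ [c] \<in> factors A s u \<Longrightarrow> b \<noteq> c \<Longrightarrow>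
    suffix p s \<or> suffix s p"
proof (induction arbitrary: p b c rule: standard_pair.induct)
  case base
  then show ?case by simp
next
  case (step s u a)
  let ?u = "\<lambda>b. if b = a then u a else u b @ u a"
  note sp = standard_pair.step[OF step.hyps]
  have sub: "f \<in> factors A s u" if "f \<in> factors A (s @ u a) ?u" for f
  proof -
    from that obtain z where "z \<in> lists A" "sublist f ((s @ u a) @ concat (map ?u z))"
      by (auto simp: factors_def)
    then have "a # pad a z \<in> lists A" "sublist f (s @ concat (map u (a # pad a z)))"
      using step.hyps(2) pad_lists[OF step.hyps(2)] by (simp_all add: concat_map_pad)
    then show ?thesis unfolding factors_def by blast
  qed
  \<comment> \<open>Synchronisation puts the end of \<open>p\<close> at an old block boundary
    followed by \<open>u b\<close>. By \<open>pad_before_other\<close> the text up to there is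
    \<open>s @ u a\<close> followed by new blocks, so it ends in \<open>s @ u a\<close>.\<close>
  have main: "suffix p (s @ u a) \<or> suffix (s @ u a) p"
    if b: "p @ [b] \<in> factors A (s @ u a) ?u" "b \<noteq> a" and p: "suffix s p" for b
  proof -
    from b obtain z where z: "z \<in> lists A" "sublist (p @ [b]) ((s @ u a) @ concat (map ?u z))"
      by (auto simp: factors_def)
    then obtain x y where "(s @ u a) @ concat (map ?u z) = x @ (p @ [b]) @ y"
      by (auto simp: sublist_def)
    moreover from p obtain p1 where p1: "p = p1 @ s" by (auto simp: suffix_def)
    ultimately have eq: "s @ concat (map u (a # pad a z)) = (x @ p1) @ s @ b # y"
      by (simp add: concat_map_pad)
    from standard_pair_sync[OF step.hyps(1) eq] obtain z1 z2 where
      z12: "a # pad a z = z1 @ z2" "(x @ p1) @ s = s @ concat (map u z1)" by blast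
    have "s @ concat (map u z1) @ concat (map u z2) = (x @ p1) @ s @ b # y"
      using eq z12(1) by simp
    then have "concat (map u z2) = b # y" using z12(2) by (metis append.assoc same_append_eq)
    then obtain c z3 where "z2 = c # z3" by (cases z2) auto
    with \<open>concat (map u z2) = b # y\<close> have "z2 = b # z3"
      using standard_pair_hd[OF step.hyps(1), of c] by auto
    with z12 b(2) obtain z1' where "z1 = a # pad a z1'" using pad_before_other by metis
    with z12 p1 have "x @ p = (s @ u a) @ concat (map ?u z1')"
      by (simp add: concat_map_pad)
    then have "suffix (s @ u a) (x @ p)" using standard_pair_suffix[OF sp] by metis
    moreover have "suffix p (x @ p)" by (simp add: suffixI)
    ultimately show ?thesis using suffix_same_cases by blast
  qed
  from step.IH[OF sub[OF step.prems(1)] sub[OF step.prems(2)] step.prems(3)]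
  show ?case
  proof
    assume "suffix p s"
    then have "suffix p (s @ u a)"
      using standard_pair_suffix1[OF step.hyps(1)] suffix_order.trans by blast
    then show ?thesis ..
  next
    assume "suffix s p"
    then show ?thesis using main[OF step.prems(1)] main[OF step.prems(2)] step.prems(3) by blast
  qed
qed

text \<open>Drop trailing blocks beyond the window \<open>f\<close> until it reaches into the last
  one. The copy of \<open>s\<close> that ends where this block begins then lies inside the
  window.\<close>

lemma long_factor_contains:
  assumes "standard_pair A s u" and "\<And>b. b \<in> A \<Longrightarrow> length (u b) \<le> M"
    and "f \<in> factors A s u" and "length s + M \<le> length f"
  shows "sublist s f"
proof -
  from assms(3) obtain x y z where "z \<in> lists A" "s @ concat (map u z) = x @ f @ y"
    by (auto simp: factors_def sublist_def)
  then show ?thesis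
  proof (induction z arbitrary: y rule: rev_induct)
    case Nil
    then have "x = []" "f = s" using assms(4)
      by (auto dest: arg_cong[where f=length])
    then show ?case by simp
  next
    case (snoc c z)
    show ?case
    proof (cases "length (u c) \<le> length y")
      case True
      have "(x @ f) @ y = (s @ concat (map u z)) @ u c" using snoc.prems(2) by simp
      then have "suffix (u c) ((x @ f) @ y)" by (metis suffixI)
      then have "suffix (u c) y" using True suffixI[OF refl] suffix_length_suffix by metis
      then obtain y' where "y = y' @ u c" by (auto simp: suffix_def)
      with snoc.prems have "s @ concat (map u z) = x @ f @ y'" by simp
      with snoc show ?thesis by auto
    next
      case False
      obtain t where t: "s @ concat (map u z) = t @ s"
        using standard_pair_suffix[OF assms(1)] by (auto simp: suffix_def)
      have "(s @ concat (map u z)) @ u c = x @ f @ y" using snoc.prems(2) by simp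
      then have eq: "t @ s @ u c = x @ f @ y" unfolding t by simp
      have "length (u c) \<le> M" using snoc.prems(1) assms(2) by auto
      then have len: "length x \<le> length t" "length y < length (u c)"
        using False assms(4) arg_cong[OF eq, of length] by auto
      have "prefix x (t @ s @ u c)" using eq by simp
      then have "prefix x t" using len by (meson prefixI prefix_length_prefix)
      then obtain t' where "t = x @ t'" by (auto simp: prefix_def)
      with eq have eq': "t' @ s @ u c = f @ y" by simp
      then have "prefix (t' @ s) (f @ y)" by (metis append.assoc prefixI)
      then have "prefix (t' @ s) f"
        using len arg_cong[OF eq', of length] prefix_length_prefix[of _ "f @ y" f] by simp
      then show ?thesis by (auto simp: prefix_def sublist_def)
    qed
  qed
qed

section \<open>Central words visiting all points\<close>

definition visits :: "('a \<Rightarrow> 'r \<Rightarrow> 'r) \<Rightarrow> 'a list \<Rightarrow> 'r \<Rightarrow> 'r set" where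
  "visits g w r = (\<lambda>p. fold g p r) ` {p. prefix p w}"

lemma visits_append:
  "visits g (v @ w) r = visits g v r \<union> visits g w (fold g v r)"
proof -
  have "{p. prefix p (v @ w)} = {p. prefix p v} \<union> (@) v ` {q. prefix q w}"
    by (auto simp: prefix_append)
  then show ?thesis by (simp add: visits_def image_Un image_image)
qed

lemma start_visited: "r \<in> visits g w r"
  unfolding visits_def by (rule image_eqI[of _ _ "[]"]) auto

lemma fold_permutes:
  assumes "\<And>a. a \<in> A \<Longrightarrow> g a permutes R" "w \<in> lists A"
  shows "fold g w permutes R"
  using assms(2)
proof (induction w)
  case Nil
  then show ?case by (simp add: permutes_id flip: id_def)
next
  case (Cons a w)
  then have "fold g w \<circ> g a permutes R" using assms(1) by (intro permutes_compose) auto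
  then show ?case by (simp add: comp_def)
qed

lemma visits_subset:
  assumes "\<And>a. a \<in> A \<Longrightarrow> g a permutes R" "w \<in> lists A" "r \<in> R"
  shows "visits g w r \<subseteq> R"
proof
  fix t assume "t \<in> visits g w r"
  then obtain p where p: "prefix p w" "t = fold g p r" by (auto simp: visits_def)
  then have "p \<in> lists A" using assms(2) set_mono_prefix by fastforce
  then show "t \<in> R" using fold_permutes[of A g R p] assms p permutes_in_image by metis
qed

lemma permutes_power_id:
  assumes "finite R" "f permutes R"
  obtains n where "n > 0" "f ^^ n = id"
  using assms permutation_is_nilpotent permutation_permutes by metis

lemma fold_concat_replicate: "fold g (concat (replicate n w)) = fold g w ^^ n"
  by (induction n) (auto simp: funpow_swap1 fun_eq_iff)

lemma standard_pair_iterate: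
  assumes "standard_pair A s u" "a \<in> A"
  shows "standard_pair A (s @ concat (replicate n (u a)))
    (\<lambda>b. if b = a then u a else u b @ concat (replicate n (u a)))"
proof (induction n)
  case 0
  have "(\<lambda>b. if b = a then u a else u b @ concat (replicate 0 (u a))) = u" by auto
  then show ?case using assms(1) by simp
next
  case (Suc n)
  have rep: "concat (replicate n (u a)) @ u a = concat (replicate (Suc n) (u a))"
    by (induction n) auto
  let ?u = "\<lambda>b. if b = a then u a else u b @ concat (replicate n (u a))"
  have "(\<lambda>b. if b = a then ?u a else ?u b @ ?u a) =
    (\<lambda>b. if b = a then u a else u b @ concat (replicate (Suc n) (u a)))"
    using rep by auto
  moreover have "(s @ concat (replicate n (u a))) @ ?u a = s @ concat (replicate (Suc n) (u a))"
    using rep by simp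
  ultimately show ?case using standard_pair.step[OF Suc assms(2)] by metis
qed

text \<open>As \<open>n\<close> is a period of the action of \<open>w\<close>, the \<open>n\<close>
  copies of \<open>w\<close> start from every point of the cycle of \<open>r\<close>.\<close>

lemma visits_concat_replicate:
  assumes "n > 0" "fold g w ^^ n = id"
  shows "visits g w ((fold g w ^^ i) r) \<subseteq> visits g (concat (replicate n w)) r"
proof -
  have less: "visits g w ((fold g w ^^ j) r) \<subseteq> visits g (concat (replicate m w)) r" if "j < m" for j m
    using that
  proof (induction m)
    case (Suc m)
    have "concat (replicate (Suc m) w) = concat (replicate m w) @ w"
      by (induction m) auto
    with Suc show ?case
      by (auto simp: visits_append fold_concat_replicate less_Suc_eq simp del: replicate_Suc)
  qed simp
  have "fold g w ^^ i = fold g w ^^ (i mod n)"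
    using assms(2) by (metis funpow_mod_eq id_apply ext)
  then show ?thesis using less[of "i mod n" n] assms(1) by simp
qed

text \<open>
  Iterating a step \<open>n\<close> times, where \<open>g a ^^ n = id\<close>, does not change the action of the words \<open>u b\<close>,
  while the sets of points that they visit can only grow. When these sets are maximal they are
  closed under the action.
\<close>
lemma exists_visiting_pair:
  assumes fin: "finite A" "finite R" and perm: "\<And>a. a \<in> A \<Longrightarrow> g a permutes R"
    and trans: "\<And>r t. r \<in> R \<Longrightarrow> t \<in> R \<Longrightarrow> \<exists>w\<in>lists A. fold g w r = t"
  obtains s u where "standard_pair A s u" "\<And>b. b \<in> A \<Longrightarrow> fold g (u b) = g b"
    "\<And>r. r \<in> R \<Longrightarrow> R \<subseteq> visits g s r"
proof -
  \<comment> \<open>The invariant of the search. Iterating a step by a period of \<open>g a\<close>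
    keeps it, since the appended copies of \<open>u a\<close> act trivially.\<close>
  define Q where "Q = (\<lambda>(s, u). standard_pair A s u \<and> (\<forall>b\<in>A. fold g (u b) = g b))"
  note pairI = that
  have result: thesis if Q: "Q (s, u)" and v: "\<And>r. r \<in> R \<Longrightarrow> R \<subseteq> visits g s r" for s u
    using Q by (intro pairI[of s u] v) (auto simp: Q_def)
  have Q0: "Q ([], \<lambda>b. [b])" by (simp add: Q_def standard_pair.base)
  have Qstep: "Q (s @ concat (replicate n (u a)),
      \<lambda>b. if b = a then u a else u b @ concat (replicate n (u a)))"
    if "Q (s, u)" "a \<in> A" "g a ^^ n = id" for s u a n
    using that standard_pair_iterate[of A s u a n]
    by (auto simp: Q_def fold_concat_replicate)
  \<comment> \<open>The maximality argument plays two different letters against each other. Without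
    letters \<open>R\<close> has at most one point, and with one letter it is a single cycle, so
    these cases are direct.\<close>
  consider "A = {}" | a where "A = {a}" | a b where "a \<in> A" "b \<in> A" "a \<noteq> b" by blast
  then show ?thesis
  proof cases
    case 1
    have "t \<in> visits g [] r" if "r \<in> R" "t \<in> R" for r t
      using trans[OF that] 1 start_visited[of r g "[]"] by auto
    then show ?thesis by (intro result[OF Q0] subsetI)
  next
    case (2 a)
    obtain n where n: "n > 0" "g a ^^ n = id"
      using permutes_power_id fin(2) perm 2 by (metis insertI1)
    have v: "t \<in> visits g ([] @ concat (replicate n [a])) r" if rt: "r \<in> R" "t \<in> R" for r t
    proof -
      obtain w where w: "w \<in> lists {a}" "fold g w r = t" using trans[OF rt] 2 by blast
      have "fold g w = g a ^^ length w" using w(1)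
        by (induction w) (auto simp: funpow_swap1 fun_eq_iff)
      with w n show ?thesis
        using visits_concat_replicate[of n g "[a]" "length w" r] start_visited[of t g "[a]"] by auto
    qed
    have Q: "Q ([] @ concat (replicate n [a]),
        \<lambda>b. if b = a then [a] else [b] @ concat (replicate n [a]))"
      using Qstep[OF Q0, of a n] 2 n by simp
    show ?thesis using v by (intro result[OF Q] subsetI)
  next
    case (3 a0 b0)
    define \<mu> where "\<mu> = (\<lambda>(s :: 'a list, u). \<Sum>(b, r)\<in>A \<times> R. card (visits g (u b) r))"
    have sub: "visits g (u b) r \<subseteq> R" if Q: "Q (s, u)" and b: "b \<in> A" and r: "r \<in> R" for s u b r
    proof -
      have "standard_pair A s u" using Q by (simp add: Q_def)
      then have "u b \<in> lists A" using standard_pair_lists b by blast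
      then show ?thesis by (rule visits_subset[of A, rotated 1]) (simp_all add: perm r)
    qed
    have bound: "\<mu> p < Suc (card (A \<times> R) * card R)" if "Q p" for p
    proof -
      obtain s u where p: "p = (s, u)" by (cases p)
      have "card (visits g (u b) r) \<le> card R" if "b \<in> A" "r \<in> R" for b r
        using card_mono[OF fin(2) sub[OF \<open>Q p\<close>[unfolded p] that]] .
      then have "\<mu> p \<le> card (A \<times> R) * card R"
        unfolding \<mu>_def p prod.case
        using sum_bounded_above[of "A \<times> R" "\<lambda>(b, r). card (visits g (u b) r)" "card R"] by auto
      then show ?thesis by simp
    qed
    have "\<exists>p. Q p \<and> (\<forall>q. Q q \<longrightarrow> \<mu> q \<le> \<mu> p)"
      by (rule Lattices_Big.ex_has_greatest_nat[of Q, OF Q0]) (use bound in blast)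
    then obtain p where p: "Q p" "\<And>q. Q q \<Longrightarrow> \<mu> q \<le> \<mu> p" by blast
    obtain s u where su: "p = (s, u)" by (cases p)
    have Qsu: "Q (s, u)" using p(1) su by simp
    have act: "fold g (u b) = g b" if "b \<in> A" for b using Qsu that by (auto simp: Q_def)
    \<comment> \<open>Iterating the step of \<open>a\<close> extends \<open>u b\<close> by copies of
      \<open>u a\<close> and decreases no summand of \<open>\<mu>\<close>. By maximality none grows,
      so the points met by these copies are already visited by \<open>u b\<close>.\<close>
    have closed: "visits g (u a) ((g a ^^ i) (g b r)) \<subseteq> visits g (u b) r"
      if ab: "a \<in> A" "b \<in> A" "a \<noteq> b" and r: "r \<in> R" for a b r i
    proof -
      obtain n where n: "n > 0" "g a ^^ n = id"
        using permutes_power_id[OF fin(2) perm[OF ab(1)]] by blast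
      let ?u = "\<lambda>b. if b = a then u a else u b @ concat (replicate n (u a))"
      have Q': "Q (s @ concat (replicate n (u a)), ?u)" using Qstep[OF Qsu ab(1) n(2)] .
      have grow: "visits g (u c) t \<subseteq> visits g (?u c) t" for c t
        by (simp add: visits_append)
      have le: "card (visits g (u c) t) \<le> card (visits g (?u c) t)" if "c \<in> A" "t \<in> R" for c t
        by (rule card_mono[OF finite_subset[OF sub[OF Q' that] fin(2)] grow])
      have "\<mu> (s, u) \<le> \<mu> (s @ concat (replicate n (u a)), ?u)"
        unfolding \<mu>_def prod.case using le by (intro sum_mono) auto
      then have "\<mu> (s, u) = \<mu> (s @ concat (replicate n (u a)), ?u)"
        using p(2)[OF Q'] su by auto
      then have "card (visits g (u b) r) = card (visits g (?u b) r)"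
        unfolding \<mu>_def prod.case
        using sum_mono_inv[of "\<lambda>(b, r). card (visits g (u b) r)" "A \<times> R"
            "\<lambda>(b, r). card (visits g (?u b) r)" "(b, r)"] le fin ab(2) r by auto
      then have "visits g (u b) r = visits g (?u b) r"
        by (rule card_subset_eq[OF finite_subset[OF sub[OF Q' ab(2) r] fin(2)] grow])
      then have "visits g (concat (replicate n (u a))) (g b r) \<subseteq> visits g (u b) r"
        using ab act by (auto simp: visits_append)
      then show ?thesis
        using visits_concat_replicate[of n g "u a" i "g b r"] act[OF ab(1)] n by auto
    qed
    have in_R: "g b r \<in> R" if "b \<in> A" "r \<in> R" for b r
      using perm that permutes_in_image by metis
    have closed': "visits g (u a) (g b r) \<subseteq> visits g (u b) r"
      if ab: "a \<in> A" "b \<in> A" and r: "r \<in> R" for a b r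
    proof (cases "a = b")
      case False
      then show ?thesis using closed[of a b r 0] that by simp
    next
      case True
      obtain c where c: "c \<in> A" "c \<noteq> a" using 3 by metis
      obtain n where n: "n > 0" "g c ^^ n = id"
        using permutes_power_id[OF fin(2) perm[OF c(1)]] by blast
      \<comment> \<open>A detour through another letter: \<open>?t\<close> is the preimage of
        \<open>g a r\<close> under \<open>g c\<close> and also lies on its cycle, so
        \<open>closed\<close> applies once in each direction.\<close>
      let ?t = "(g c ^^ (n - 1)) (g a r)"
      have "g c ?t = g a r" using n by (metis Suc_diff_1 comp_apply funpow.simps(2) id_apply)
      moreover have "?t \<in> R"
        using permutes_in_image[OF permutes_funpow[OF perm[OF c(1)]]] in_R[OF ab(1) r] by simp
      ultimately have "visits g (u a) (g a r) \<subseteq> visits g (u c) ?t"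
        using closed[of a c ?t 0] ab c by auto
      also have "\<dots> \<subseteq> visits g (u a) r" using closed[of c a r "n - 1"] ab c r by auto
      finally show ?thesis using True by simp
    qed
    \<comment> \<open>Following a word letter by letter with \<open>closed'\<close> shows that
      \<open>u b\<close> visits the whole orbit of \<open>g b r\<close>, which is \<open>R\<close>
      by transitivity.\<close>
    have all: "fold g w (g b r) \<in> visits g (u b) r" if "w \<in> lists A" "b \<in> A" "r \<in> R" for w b r
      using that
    proof (induction w arbitrary: b r)
      case Nil
      then show ?case using closed'[of b b r] start_visited[of "g b r" g "u b"] by auto
    next
      case (Cons c w)
      have "fold g w (g c (g b r)) \<in> visits g (u c) (g b r)" using Cons in_R by simp
      then show ?case using closed'[OF Cons.hyps(1) Cons.prems] by auto
    qed
    \<comment> \<open>One last iteration moves at least one copy of \<open>u a0\<close> into the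
      central word.\<close>
    obtain n where n: "n > 0" "g a0 ^^ n = id"
      using permutes_power_id[OF fin(2) perm[OF 3(1)]] by blast
    have "R \<subseteq> visits g (s @ concat (replicate n (u a0))) r" if r: "r \<in> R" for r
    proof
      fix t assume t: "t \<in> R"
      have "s \<in> lists A" using Qsu standard_pair_lists unfolding Q_def by blast
      then have "fold g s permutes R" by (rule fold_permutes[of A, rotated 1]) (rule perm)
      then have "fold g s r \<in> R" using r by (simp add: permutes_in_image)
      then obtain w where "w \<in> lists A" "fold g w (g a0 (fold g s r)) = t"
        using trans t in_R[OF 3(1)] by blast
      then have "t \<in> visits g (u a0) (fold g s r)"
        using all[of w a0 "fold g s r"] 3 \<open>fold g s r \<in> R\<close> by auto
      then show "t \<in> visits g (s @ concat (replicate n (u a0))) r"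
        using visits_concat_replicate[of n g "u a0" 0 "fold g s r"] n act[OF 3(1)]
        by (auto simp: visits_append)
    qed
    then show ?thesis by (intro result[OF Qstep[OF Qsu 3(1) n(2)]])
  qed
qed

section \<open>First return words\<close>

locale return_code =
  fixes A :: "'a set" and g :: "'a \<Rightarrow> 'r \<Rightarrow> 'r" and R :: "'r set" and r0 :: 'r
    and s :: "'a list" and u :: "'a \<Rightarrow> 'a list"
  assumes finite_A: "finite A" and finite_R: "finite R" and r0: "r0 \<in> R"
    and perm: "\<And>a. a \<in> A \<Longrightarrow> g a permutes R"
    and pair: "standard_pair A s u"
    and act_u: "\<And>b. b \<in> A \<Longrightarrow> fold g (u b) = g b"
    and hit: "\<And>r. r \<in> R \<Longrightarrow> r0 \<in> visits g s r"
begin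

abbreviation F :: "'a list set" where "F \<equiv> factors A s u"

definition no_return :: "'a list \<Rightarrow> bool" where
  "no_return p \<longleftrightarrow> (\<forall>q. prefix q p \<longrightarrow> fold g q r0 = r0 \<longrightarrow> q = [])"

text \<open>These are the proper prefixes of the words of \<open>X\<close> below (and the empty word).\<close>
definition P :: "'a list set" where
  "P = {p \<in> F. no_return p}"

definition X :: "'a list set" where
  "X = {p @ [c] | p c. p \<in> P \<and> p @ [c] \<in> F \<and> fold g (p @ [c]) r0 = r0}"

definition right_ext :: "'a list \<Rightarrow> 'a set" where
  "right_ext p = {c \<in> A. p @ [c] \<in> F}"

lemma concat_map_u_lists: "z \<in> lists A \<Longrightarrow> concat (map u z) \<in> lists A"
  using standard_pair_lists[OF pair] by (induction z) auto

lemma s_lists: "s \<in> lists A"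
  using standard_pair_lists[OF pair] by blast

lemma F_lists: "f \<in> F \<Longrightarrow> f \<in> lists A"
proof -
  assume "f \<in> F"
  then obtain z where "z \<in> lists A" "sublist f (s @ concat (map u z))"
    by (auto simp: factors_def)
  moreover from this(1) have "s @ concat (map u z) \<in> lists A"
    using s_lists concat_map_u_lists by simp
  ultimately show ?thesis using set_mono_sublist by (metis in_lists_conv_set subsetD)
qed

lemma F_set: "f \<in> F \<Longrightarrow> set f \<subseteq> A"
  using F_lists by (metis in_lists_conv_set subsetI)

lemma F_sublist: "f \<in> F \<Longrightarrow> sublist e f \<Longrightarrow> e \<in> F"
  unfolding factors_def using sublist_order.order.trans by blast

lemma F_append: "x @ y \<in> F \<Longrightarrow> x \<in> F" "x @ y \<in> F \<Longrightarrow> y \<in> F"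
  using F_sublist[of "x @ y" x] F_sublist[of "x @ y" y] by simp_all

lemma act_permutes: "w \<in> lists A \<Longrightarrow> fold g w permutes R"
  by (rule fold_permutes[of A]) (rule perm)

lemma act_in_R: "w \<in> lists A \<Longrightarrow> r \<in> R \<Longrightarrow> fold g w r \<in> R"
  using act_permutes[of w] permutes_in_image by metis

lemma act_inj:
  assumes "w \<in> lists A" "fold g w r = fold g w t" shows "r = t"
  using permutes_inj[OF act_permutes[OF assms(1)]] assms(2) by (auto dest: injD)

lemma no_return_Nil [simp]: "no_return []"
  by (simp add: no_return_def)

lemma no_return_snoc: "no_return (p @ [c]) \<longleftrightarrow> no_return p \<and> fold g (p @ [c]) r0 \<noteq> r0"
  unfolding no_return_def prefix_snoc by auto

text \<open>Two such cuts differ by a word \<open>t\<close> that leads from \<open>r0\<close> to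
  \<open>r0\<close> and begins a word without return, hence is empty.\<close>

lemma no_return_unique:
  assumes "a @ p = b @ q" "fold g a r0 = r0" "fold g b r0 = r0" "no_return p" "no_return q"
  shows "a = b \<and> p = q"
proof -
  from assms(1) obtain t where "a = b @ t \<and> t @ p = q \<or> a @ t = b \<and> p = t @ q"
    unfolding append_eq_append_conv2 by blast
  then show ?thesis
  proof
    assume t: "a = b @ t \<and> t @ p = q"
    then have "fold g t r0 = r0" "prefix t q" using assms(2,3) by auto
    then show ?thesis using t assms(5) unfolding no_return_def by force
  next
    assume t: "a @ t = b \<and> p = t @ q"
    then have "fold g t r0 = r0" "prefix t p" using assms(2,3) by auto
    then show ?thesis using t assms(4) unfolding no_return_def by force
  qed
qed

lemma last_visit:
  assumes "r0 \<in> visits g w t"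
  obtains q p where "w = q @ p" "fold g q t = r0" "no_return p"
  using assms
proof (induction w arbitrary: thesis rule: rev_induct)
  case Nil
  then show ?case by (auto simp: visits_def)
next
  case (snoc c w)
  show ?case
  proof (cases "fold g (w @ [c]) t = r0")
    case True
    then show ?thesis using snoc.prems(1)[of "w @ [c]" "[]"] by simp
  next
    case False
    then have "r0 \<in> visits g w t"
      using snoc.prems(2) by (auto simp: visits_def prefix_snoc)
    then obtain q p where qp: "w = q @ p" "fold g q t = r0" "no_return p"
      using snoc.IH by blast
    then have "no_return (p @ [c])" using False by (simp add: no_return_snoc)
    then show ?thesis using snoc.prems(1)[of q "p @ [c]"] qp by simp
  qed
qed

section \<open>The prefix tree and the bifix property\<close>

lemma Nil_in_P: "[] \<in> P"
  by (auto simp: P_def factors_def intro: exI[of _ "[]"])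

lemma P_snoc: "p @ [c] \<in> P \<longleftrightarrow> p \<in> P \<and> p @ [c] \<in> F \<and> fold g (p @ [c]) r0 \<noteq> r0"
  using F_append(1)[of p "[c]"] by (auto simp: P_def no_return_snoc)

lemma X_iff: "p @ [c] \<in> X \<longleftrightarrow> p \<in> P \<and> p @ [c] \<in> F \<and> fold g (p @ [c]) r0 = r0"
  by (auto simp: X_def)

lemma X_return:
  assumes "x \<in> X"
  shows "x \<noteq> []" "x \<in> lists A" "fold g x r0 = r0"
    "strict_prefix q x \<Longrightarrow> fold g q r0 = r0 \<Longrightarrow> q = []"
proof -
  obtain p c where x: "x = p @ [c]" "p \<in> P" "x \<in> F" "fold g x r0 = r0"
    using assms by (auto simp: X_def)
  show "x \<noteq> []" using x by simp
  show "x \<in> lists A" using F_lists[OF x(3)] .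
  show "fold g x r0 = r0" by (rule x(4))
  show "q = []" if "strict_prefix q x" "fold g q r0 = r0"
    using that x by (auto simp: P_def no_return_def strict_prefix_def prefix_snoc)
qed

text \<open>Prefixes are excluded by first return. If \<open>y = t @ x\<close>, injectivity of the
  action of \<open>x\<close> shows that \<open>t\<close> already returns to
  \<open>r0\<close>.\<close>

lemma bifix_X: "bifix_code X"
proof -
  have "\<not> strict_suffix x y" if x: "x \<in> X" and y: "y \<in> X" for x y
  proof
    assume "strict_suffix x y"
    then obtain t where t: "y = t @ x" "t \<noteq> []" by (auto simp: strict_suffix_def suffix_def)
    have "fold g x (fold g t r0) = fold g x r0" using X_return(3)[OF x] X_return(3)[OF y] t by simp
    then have "fold g t r0 = r0" using act_inj X_return(2)[OF x] by blast
    moreover have "strict_prefix t y" using t X_return(1)[OF x] by (auto simp: strict_prefix_def)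
    ultimately show False using X_return(4)[OF y] t by blast
  qed
  moreover have "\<not> strict_prefix x y" if "x \<in> X" "y \<in> X" for x y
    using X_return(1,3)[OF that(1)] X_return(4)[OF that(2)] by blast
  ultimately show ?thesis using X_return(1) unfolding bifix_code_def by blast
qed

text \<open>Reading \<open>s\<close> after \<open>a\<close> meets \<open>r0\<close> by
  \<open>hit\<close>, which a word without return allows only at its very start. This bounds the
  length of the words in \<open>P\<close> and excludes branching beyond \<open>s\<close>.\<close>

lemma P_no_inner_s:
  assumes "a @ s @ b \<in> P" shows "a = []"
proof -
  have "a @ s @ b \<in> lists A" using assms F_lists unfolding P_def by blast
  then have "fold g a r0 \<in> R" using act_in_R r0 by simp
  from hit[OF this] obtain q where "prefix q s" "fold g q (fold g a r0) = r0"
    by (auto simp: visits_def)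
  then have "prefix (a @ q) (a @ s @ b)" "fold g (a @ q) r0 = r0" by simp_all
  then have "a @ q = []" using assms unfolding P_def no_return_def by blast
  then show ?thesis by simp
qed

lemma finite_P: "finite P"
proof -
  define M where "M = Max (insert 0 ((\<lambda>b. length (u b)) ` A))"
  have M: "length (u b) \<le> M" if "b \<in> A" for b
    unfolding M_def using finite_A that by (intro Max_ge) auto
  have "length p \<le> length s + M" if p: "p \<in> P" for p
  proof (rule ccontr)
    assume "\<not> length p \<le> length s + M"
    \<comment> \<open>One letter is removed so that the copy of \<open>s\<close> found in
      \<open>p'\<close> does not stand at the beginning of \<open>p\<close>.\<close>
    then obtain c p' where p': "p = c # p'" "length s + M \<le> length p'" by (cases p) auto
    then have "p' \<in> F" using p F_append(2)[of "[c]" p'] by (auto simp: P_def)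
    from long_factor_contains[OF pair M this p'(2)] obtain x y where "p' = x @ s @ y"
      by (auto simp: sublist_def)
    then show False using P_no_inner_s[of "c # x" y] p p' by simp
  qed
  then have "P \<subseteq> {p. set p \<subseteq> A \<and> length p \<le> length s + M}"
    using F_set by (auto simp: P_def)
  then show ?thesis using finite_lists_length_le[OF finite_A] finite_subset by blast
qed

lemma finite_X: "finite X"
proof -
  have "X \<subseteq> (\<lambda>(p, c). p @ [c]) ` (P \<times> A)"
  proof
    fix x assume "x \<in> X"
    then obtain p c where "x = p @ [c]" "p \<in> P" "p @ [c] \<in> F" by (auto simp: X_def)
    moreover from F_set[OF this(3)] have "c \<in> A" by simp
    ultimately show "x \<in> (\<lambda>(p, c). p @ [c]) ` (P \<times> A)" by force
  qed
  then show ?thesis using finite_P finite_A finite_subset by blast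
qed

section \<open>Branching of the tree and the number of leaves\<close>

lemma ext_suffix:
  assumes "suffix p s" shows "right_ext p = A"
proof -
  have "p @ [c] \<in> F" if c: "c \<in> A" for c
  proof -
    obtain v where "u c = c # v" using standard_pair_hd[OF pair] by blast
    moreover obtain t where "s = t @ p" using assms by (auto simp: suffix_def)
    ultimately have "s @ concat (map u [c]) = t @ (p @ [c]) @ v" by simp
    then have "sublist (p @ [c]) (s @ concat (map u [c]))" unfolding sublist_def by blast
    then show ?thesis using c unfolding factors_def by (intro CollectI bexI[of _ "[c]"]) auto
  qed
  then show ?thesis by (auto simp: right_ext_def)
qed

lemma ext_nonempty:
  assumes "p \<in> F" "A \<noteq> {}" shows "right_ext p \<noteq> {}"
proof -
  obtain x y z where z: "z \<in> lists A" "s @ concat (map u z) = x @ p @ y"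
    using assms(1) by (auto simp: factors_def sublist_def)
  obtain a where a: "a \<in> A" using assms(2) by blast
  obtain v where v: "u a = a # v" using standard_pair_hd[OF pair] by blast
  \<comment> \<open>The further block \<open>u a\<close> supplies a next letter even if
    \<open>y\<close> is empty.\<close>
  obtain c y' where y': "y @ u a = c # y'" using v by (cases "y @ u a") auto
  have "s @ concat (map u (z @ [a])) = x @ p @ y @ u a" using z(2) by simp
  then have "s @ concat (map u (z @ [a])) = x @ (p @ [c]) @ y'" using y' by simp
  then have "sublist (p @ [c]) (s @ concat (map u (z @ [a])))" unfolding sublist_def by blast
  then have "p @ [c] \<in> F" using z(1) a unfolding factors_def
    by (intro CollectI bexI[of _ "z @ [a]"]) auto
  then show ?thesis using F_set[of "p @ [c]"] by (auto simp: right_ext_def)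
qed

text \<open>A second extension would make \<open>p\<close> right special, so \<open>p\<close> would
  end in \<open>s\<close>; then \<open>P_no_inner_s\<close> gives \<open>p = s\<close>, a suffix of
  \<open>s\<close> after all.\<close>

lemma card_ext_non_suffix:
  assumes "p \<in> P" "\<not> suffix p s" shows "card (right_ext p) = 1"
proof -
  have "p \<noteq> []" using assms(2) by auto
  then have "A \<noteq> {}" using assms(1) F_set[of p] by (cases p) (auto simp: P_def)
  then obtain c where c: "c \<in> right_ext p" using ext_nonempty assms(1) by (auto simp: P_def)
  have "b = c" if "b \<in> right_ext p" for b
  proof (rule ccontr)
    assume "b \<noteq> c"
    then have "suffix p s \<or> suffix s p"
      using standard_pair_right_special[OF pair] that c by (auto simp: right_ext_def)
    then obtain t where "p = t @ s" using assms(2) by (auto simp: suffix_def)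
    moreover from this have "t = []" using P_no_inner_s[of t "[]"] assms(1) by simp
    ultimately show False using assms(2) by simp
  qed
  with c have "right_ext p = {c}" by blast
  then show ?thesis by simp
qed

text \<open>Suffixes of \<open>s\<close> are comparable; if \<open>p = t @ q\<close> and both lead
  to the same point, \<open>t\<close> returns to \<open>r0\<close> and is empty. To reach
  \<open>r\<close>, take the path of \<open>s\<close> that ends in \<open>r\<close> and keep what
  follows its last visit to \<open>r0\<close>.\<close>

lemma bij_suffix_nodes: "bij_betw (\<lambda>p. fold g p r0) {p \<in> P. suffix p s} R"
proof (rule bij_betw_imageI)
  have eq: "p = q" if "p = t @ q" "p \<in> P" "fold g p r0 = fold g q r0" for p q t
  proof -
    have "p \<in> lists A" using that(2) F_lists unfolding P_def by blast
    then have "q \<in> lists A" using that(1) by simp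
    then have "fold g t r0 = r0" using that(1,3) act_inj[of q] by simp
    then show ?thesis using that(1,2) by (auto simp: P_def no_return_def)
  qed
  show "inj_on (\<lambda>p. fold g p r0) {p \<in> P. suffix p s}"
  proof (rule inj_onI)
    fix p q assume pq: "p \<in> {p \<in> P. suffix p s}" "q \<in> {p \<in> P. suffix p s}"
      "fold g p r0 = fold g q r0"
    then have "suffix p q \<or> suffix q p" using suffix_same_cases by blast
    then obtain t where "q = t @ p \<or> p = t @ q" by (auto simp: suffix_def)
    then show "p = q" using eq[of p t q] eq[of q t p] pq by (metis (lifting) mem_Collect_eq)
  qed
  show "(\<lambda>p. fold g p r0) ` {p \<in> P. suffix p s} = R"
  proof (intro equalityI subsetI)
    fix r assume "r \<in> (\<lambda>p. fold g p r0) ` {p \<in> P. suffix p s}"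
    then show "r \<in> R" using act_in_R r0 F_lists by (auto simp: P_def)
  next
    fix r assume r: "r \<in> R"
    have "fold g s permutes R" using act_permutes s_lists by blast
    then obtain t where t: "t \<in> R" "fold g s t = r"
      using r by (metis permutes_image imageE)
    obtain q p where qp: "s = q @ p" "fold g q t = r0" "no_return p"
      using last_visit[OF hit[OF t(1)]] by blast
    have "s \<in> F" by (auto simp: factors_def intro: exI[of _ "[]"])
    then have "p \<in> F" using qp(1) F_append(2)[of q p] by simp
    then have "p \<in> P" using qp(3) unfolding P_def by blast
    moreover have "fold g p r0 = r" using qp t by auto
    moreover have "suffix p s" using qp(1) by (rule suffixI)
    ultimately show "r \<in> (\<lambda>p. fold g p r0) ` {p \<in> P. suffix p s}" by blast
  qed
qed

text \<open>The edges of the tree are counted by their ends, \<open>card P - 1 + card X\<close>, and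
  by their starts: \<open>card A\<close> at each of the \<open>card R\<close> suffix nodes, one at
  every other node. Integers are used since \<open>A\<close> may be empty; then \<open>R\<close> is
  one point and \<open>X\<close> is empty.\<close>

lemma card_X: "int (card X) = (int (card A) - 1) * int (card R) + 1"
proof -
  let ?S = "{p \<in> P. suffix p s}" and ?N = "{p \<in> P. \<not> suffix p s}"
  have SN: "?S \<union> ?N = P" "finite ?S" "finite ?N" "?S \<inter> ?N = {}" using finite_P by auto
  have cS: "card ?S = card R" using bij_betw_same_card[OF bij_suffix_nodes] .
  have img: "(\<lambda>(p, c). p @ [c]) ` Sigma P right_ext = (P - {[]}) \<union> X"
  proof (intro equalityI subsetI)
    fix w assume "w \<in> (\<lambda>(p, c). p @ [c]) ` Sigma P right_ext"
    then obtain p c where "w = p @ [c]" "p \<in> P" "p @ [c] \<in> F" by (auto simp: right_ext_def)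
    then show "w \<in> (P - {[]}) \<union> X" using P_snoc X_iff by auto
  next
    fix w assume w: "w \<in> (P - {[]}) \<union> X"
    then have "w \<noteq> []" using X_return(1) by blast
    then obtain p c where pc: "w = p @ [c]" by (cases w rule: rev_cases) auto
    then have "p \<in> P" "p @ [c] \<in> F" using w P_snoc X_iff by auto
    moreover from F_set[OF this(2)] have "c \<in> A" by simp
    ultimately show "w \<in> (\<lambda>(p, c). p @ [c]) ` Sigma P right_ext" using pc by (force simp: right_ext_def)
  qed
  have "inj_on (\<lambda>(p, c). p @ [c]) (Sigma P right_ext)" by (auto simp: inj_on_def)
  from card_image[OF this] have "card (Sigma P right_ext) = card ((P - {[]}) \<union> X)" unfolding img by simp
  also have "\<dots> = card (P - {[]}) + card X"
  proof (rule card_Un_disjoint)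
    show "(P - {[]}) \<inter> X = {}" using X_return(3) by (auto simp: P_def no_return_def)
  qed (use finite_P finite_X in auto)
  also have "card (P - {[]}) = card P - 1" using Nil_in_P by simp
  finally have 1: "card (Sigma P right_ext) = card P - 1 + card X" .
  have "card (Sigma P right_ext) = (\<Sum>p\<in>P. card (right_ext p))"
    using finite_P finite_A by (intro card_SigmaI) (auto simp: right_ext_def)
  also have "\<dots> = (\<Sum>p\<in>?S. card (right_ext p)) + (\<Sum>p\<in>?N. card (right_ext p))"
    using sum.union_disjoint[OF SN(2,3,4), of "\<lambda>p. card (right_ext p)"] unfolding SN(1) .
  also have "\<dots> = card R * card A + card ?N"
    using ext_suffix card_ext_non_suffix cS by simp
  finally have 2: "card (Sigma P right_ext) = card R * card A + card ?N" .
  have 3: "card P = card R + card ?N" using card_Un_disjoint[OF SN(2,3,4)] cS unfolding SN(1) by simp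
  have "card R > 0" using r0 finite_R by (auto simp: card_gt_0_iff)
  with 1 2 3 have "card R + card X = card R * card A + 1" by linarith
  then have "int (card R) + int (card X) = int (card R) * int (card A) + 1"
    by (metis of_nat_1 of_nat_add of_nat_mult)
  then show ?thesis by (simp add: algebra_simps)
qed

end

section \<open>The maximal group\<close>

lemma star_Nil: "[] \<in> star X"
  unfolding star_def by (auto intro: exI[of _ "[]"])

lemma star_append: "y \<in> star X \<Longrightarrow> z \<in> star X \<Longrightarrow> y @ z \<in> star X"
proof -
  assume "y \<in> star X" "z \<in> star X"
  then obtain ws vs where "y = concat ws" "set ws \<subseteq> X" "z = concat vs" "set vs \<subseteq> X"
    by (auto simp: star_def)
  then have "y @ z = concat (ws @ vs)" "set (ws @ vs) \<subseteq> X" by auto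
  then show ?thesis unfolding star_def by blast
qed

lemma star_base: "x \<in> X \<Longrightarrow> x \<in> star X"
  unfolding star_def by (intro CollectI exI[of _ "[x]"]) auto

lemma star_induct [consumes 1, case_names Nil append]:
  assumes "w \<in> star X" "Q []"
    "\<And>x w. x \<in> X \<Longrightarrow> w \<in> star X \<Longrightarrow> Q w \<Longrightarrow> Q (x @ w)"
  shows "Q w"
proof -
  obtain ws where "w = concat ws" "set ws \<subseteq> X" using assms(1) by (auto simp: star_def)
  moreover have "set ws \<subseteq> X \<Longrightarrow> Q (concat ws)" for ws
  proof (induction ws)
    case (Cons x ws)
    then have "concat ws \<in> star X" by (auto simp: star_def)
    then show ?case using Cons assms(3) by simp
  qed (simp add: assms(2))
  ultimately show ?thesis by simp
qed

text \<open>The first code words of the two factorisations are prefixes of one word, hence equal,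
  and cancel one at a time.\<close>

lemma star_left_cancel:
  assumes "bifix_code X" "y \<in> star X" "y @ z \<in> star X"
  shows "z \<in> star X"
  using assms(2,3)
proof (induction rule: star_induct)
  case (append x w)
  obtain ws where ws: "x @ w @ z = concat ws" "set ws \<subseteq> X"
    using append.prems by (auto simp: star_def)
  have "x \<noteq> []" using append.hyps(1) assms(1) by (auto simp: bifix_code_def)
  with ws obtain x' ws' where ws': "ws = x' # ws'" by (cases ws) auto
  then have eq: "x @ w @ z = x' @ concat ws'" "x' \<in> X" "concat ws' \<in> star X"
    using ws by (auto simp: star_def)
  then have "prefix x x' \<or> prefix x' x"
    by (metis prefixI prefix_same_cases)
  then have "x = x'" using assms(1) append.hyps(1) eq(2)
    unfolding bifix_code_def strict_prefix_def by blast
  then have "w @ z \<in> star X" using eq by simp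
  then show ?case by (rule append.IH)
qed simp

lemma lquot_lquot: "lquot b (lquot a L) = lquot (a @ b) L"
  by (simp add: lquot_def)

lemma trans_map_append:
  assumes "v \<in> lists A"
  shows "trans_map A L (v @ w) = pmult (trans_map A L v) (trans_map A L w)"
proof
  fix q
  show "trans_map A L (v @ w) q = pmult (trans_map A L v) (trans_map A L w) q"
  proof (cases "q \<in> min_states A L \<and> lquot v q \<noteq> {}")
    case True
    then obtain a where "q = lquot a L" "a \<in> lists A" by (auto simp: min_states_def)
    then have "lquot v q = lquot (a @ v) L" "a @ v \<in> lists A" using assms by (auto simp: lquot_lquot)
    then have "lquot v q \<in> min_states A L" using True unfolding min_states_def by blast
    then show ?thesis using True
      by (auto simp: pmult_def map_comp_def trans_map_def lquot_lquot)
  next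
    case False
    moreover have "lquot v q = {} \<Longrightarrow> lquot (v @ w) q = {}" by (simp add: lquot_def)
    ultimately show ?thesis by (auto simp: pmult_def map_comp_def trans_map_def)
  qed
qed

section \<open>States of the minimal automaton\<close>

context return_code
begin

abbreviation L :: "'a list set" where "L \<equiv> star X"
abbreviation \<psi> :: "'a list \<Rightarrow> 'a list" where "\<psi> z \<equiv> concat (map u z)"

lemma star_X_return: "y \<in> L \<Longrightarrow> y \<in> lists A \<and> fold g y r0 = r0"
proof (induction rule: star_induct)
  case (append x w)
  then show ?case using X_return(2,3)[OF append.hyps(1)] by simp
qed simp

lemma P_prefix: "p \<in> P \<Longrightarrow> prefix q p \<Longrightarrow> q \<in> P"
  using F_append(1) prefix_order.trans unfolding P_def no_return_def by (auto simp: prefix_def)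

text \<open>A cut through a factorisation leaves complete code words followed by a proper prefix of
  one, which is a node of \<open>P\<close>.\<close>

lemma star_X_prefix:
  assumes "w @ v \<in> L"
  obtains y p where "y \<in> L" "p \<in> P" "w = y @ p"
proof -
  obtain ws where "concat ws = w @ v" "set ws \<subseteq> X" using assms by (auto simp: star_def)
  then have "\<exists>y\<in>L. \<exists>p\<in>P. w = y @ p"
  proof (induction ws arbitrary: w)
    case Nil
    then show ?case using star_Nil Nil_in_P by auto
  next
    case (Cons x ws)
    from Cons.prems have "x @ concat ws = w @ v" by simp
    then obtain t where t: "x = w @ t \<or> x @ t = w \<and> concat ws = t @ v"
      unfolding append_eq_append_conv2 by blast
    have x: "x \<in> X" using Cons.prems by simp
    from t show ?case
    proof
      assume xt: "x = w @ t"
      show ?thesis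
      proof (cases t rule: rev_cases)
        case Nil
        then have "w = x @ []" using xt by simp
        then show ?thesis using star_base[OF x] Nil_in_P by blast
      next
        case (snoc t' c)
        then have "w @ t' \<in> P" using x xt X_iff[of "w @ t'" c] by simp
        then have "w \<in> P" using P_prefix by simp
        moreover have "w = [] @ w" by simp
        ultimately show ?thesis using star_Nil by blast
      qed
    next
      assume xt: "x @ t = w \<and> concat ws = t @ v"
      then obtain y p where "y \<in> L" "p \<in> P" "t = y @ p"
        using Cons.IH[of t] Cons.prems by auto
      then have "w = (x @ y) @ p" using xt by simp
      then show ?thesis using \<open>p \<in> P\<close> star_append[OF star_base[OF x] \<open>y \<in> L\<close>] by blast
    qed
  qed
  then show ?thesis using that by blast
qed

text \<open>Greedy parsing: a letter extending a node within \<open>F\<close> leads to another node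
  or completes a code word.\<close>

lemma F_decomp: "f \<in> F \<Longrightarrow> \<exists>y\<in>L. \<exists>p\<in>P. f = y @ p"
proof (induction f rule: rev_induct)
  case Nil
  then show ?case using star_Nil Nil_in_P by auto
next
  case (snoc c f)
  then obtain y p where yp: "y \<in> L" "p \<in> P" "f = y @ p" using F_append(1) by blast
  then have "p @ [c] \<in> F" using snoc.prems F_append(2)[of y "p @ [c]"] by simp
  then consider "p @ [c] \<in> P" | "p @ [c] \<in> X" using yp(2) P_snoc X_iff by blast
  then show ?case
  proof cases
    case 1
    moreover have "f @ [c] = y @ (p @ [c])" using yp(3) by simp
    ultimately show ?thesis using yp(1) by blast
  next
    case 2
    then have "y @ p @ [c] \<in> L" using star_append[OF yp(1) star_base] by blast
    moreover have "f @ [c] = (y @ p @ [c]) @ []" using yp(3) by simp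
    ultimately show ?thesis using Nil_in_P by blast
  qed
qed

text \<open>A longest node above \<open>p\<close> has an extension in \<open>F\<close>, which must
  be a code word. The root is treated apart because \<open>A\<close> may be empty.\<close>

lemma lquot_P_nonempty:
  assumes "p \<in> P" shows "lquot p L \<noteq> {}"
proof -
  have "finite {q \<in> P. prefix p q}" "p \<in> {q \<in> P. prefix p q}" using finite_P assms by auto
  then obtain q where q: "q \<in> P" "prefix p q"
    and q_max: "\<And>q'. q' \<in> P \<Longrightarrow> prefix p q' \<Longrightarrow> length q' \<le> length q"
    using Max_in[of "length ` {q \<in> P. prefix p q}"] Max_ge[of "length ` {q \<in> P. prefix p q}"]
    by (smt (verit, best) empty_iff finite_imageI image_iff mem_Collect_eq)
  have "\<exists>v. q @ v \<in> L"
  proof (cases "q = []")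
    case True
    then show ?thesis using star_Nil by (intro exI[of _ "[]"]) simp
  next
    case False
    then have "A \<noteq> {}" using q(1) F_set[of q] by (auto simp: P_def)
    moreover have "q \<in> F" using q(1) by (simp add: P_def)
    ultimately obtain c where "q @ [c] \<in> F" using ext_nonempty by (auto simp: right_ext_def)
    moreover have "q @ [c] \<notin> P" using q_max[of "q @ [c]"] q(2) by auto
    ultimately have "q @ [c] \<in> X" using q(1) P_snoc X_iff by blast
    then show ?thesis using star_base by blast
  qed
  then show ?thesis using q(2) by (auto simp: prefix_def lquot_def)
qed

text \<open>For \<open>r\<close> in \<open>R\<close> this is the part of \<open>s\<close> after the
  last visit to \<open>r0\<close> on its path ending in \<open>r\<close>.\<close>

definition node :: "'r \<Rightarrow> 'a list" where
  "node = the_inv_into {p \<in> P. suffix p s} (\<lambda>p. fold g p r0)"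

lemma node:
  assumes "r \<in> R"
  shows "node r \<in> P" "suffix (node r) s" "fold g (node r) r0 = r"
proof -
  have "node r \<in> {p \<in> P. suffix p s}" unfolding node_def
    using bij_betwE[OF bij_betw_the_inv_into[OF bij_suffix_nodes]] assms by blast
  then show "node r \<in> P" "suffix (node r) s" by auto
  show "fold g (node r) r0 = r" unfolding node_def
    using f_the_inv_into_f_bij_betw[OF bij_suffix_nodes] assms by blast
qed

lemma node_eq: "p \<in> P \<Longrightarrow> suffix p s \<Longrightarrow> node (fold g p r0) = p"
  unfolding node_def
  using the_inv_into_f_f[OF bij_betw_imp_inj_on[OF bij_suffix_nodes], of p] by blast

definition Q :: "'r \<Rightarrow> 'a list set" where
  "Q r = lquot (node r) L"

text \<open>All words leading from a state to acceptance lead from one and the same point of \<open>R\<close> to \<open>r0\<close>.\<close>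
definition state_type :: "'a list set \<Rightarrow> 'r" where
  "state_type q = inv (fold g (SOME v. v \<in> q)) r0"

text \<open>Every \<open>v\<close> in the quotient leads from \<open>fold g w r0\<close> to
  \<open>r0\<close> and acts injectively, so the choice of \<open>v\<close> does not matter.\<close>

lemma state_type_lquot:
  assumes "lquot w L \<noteq> {}" shows "state_type (lquot w L) = fold g w r0"
proof -
  define v where "v = (SOME v. v \<in> lquot w L)"
  have "v \<in> lquot w L" unfolding v_def using assms some_in_eq by blast
  then have "w @ v \<in> L" by (simp add: lquot_def)
  from star_X_return[OF this] have v: "v \<in> lists A" "fold g v (fold g w r0) = r0" by auto
  have "inv (fold g v) r0 = fold g w r0"
    using inv_f_f[OF permutes_inj[OF act_permutes[OF v(1)]]] v(2) by metis
  then show ?thesis unfolding state_type_def v_def .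
qed

lemma lquot_append_star:
  assumes "y \<in> L" shows "lquot (y @ p) L = lquot p L"
proof -
  have "y @ p @ v \<in> L \<longleftrightarrow> p @ v \<in> L" for v
    using star_left_cancel[OF bifix_X assms] star_append[OF assms] by blast
  then show ?thesis by (simp add: lquot_def)
qed

text \<open>Two cuts of \<open>w @ s\<close> are compared: the parse into code words and a node, and
  the cut at the last visit to \<open>r0\<close> while reading \<open>s\<close>. By
  \<open>no_return_unique\<close> they agree, so the node is a suffix of \<open>s\<close> and is
  determined by its end point.\<close>

lemma lquot_ending_s:
  assumes "lquot (w @ s) L \<noteq> {}"
  shows "lquot (w @ s) L = Q (fold g (w @ s) r0)"
proof -
  obtain v where v: "(w @ s) @ v \<in> L" using assms by (auto simp: lquot_def)
  then obtain y p where yp: "y \<in> L" "p \<in> P" "w @ s = y @ p" using star_X_prefix by metis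
  have "w \<in> lists A" using star_X_return[OF v] by simp
  then obtain q p' where q: "s = q @ p'" "fold g q (fold g w r0) = r0" "no_return p'"
    using last_visit[OF hit[OF act_in_R[OF _ r0]]] by metis
  have y: "fold g y r0 = r0" using star_X_return[OF yp(1)] by simp
  have "no_return p" using yp(2) by (simp add: P_def)
  moreover have "(w @ q) @ p' = y @ p" using yp(3) q(1) by simp
  moreover have "fold g (w @ q) r0 = r0" using q(2) by simp
  ultimately have "p' = p" using no_return_unique y q(3) by blast
  then have "suffix p s" using q(1) suffixI by blast
  moreover have "fold g (w @ s) r0 = fold g p r0" unfolding yp(3) using y by simp
  ultimately have "node (fold g (w @ s) r0) = p" using node_eq yp(2) by simp
  then show ?thesis unfolding Q_def yp(3) using lquot_append_star[OF yp(1)] by metis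
qed

lemma Q_nonempty: "r \<in> R \<Longrightarrow> Q r \<noteq> {}"
  unfolding Q_def using lquot_P_nonempty node(1) by blast

lemma state_type_Q: "r \<in> R \<Longrightarrow> state_type (Q r) = r"
  using state_type_lquot Q_nonempty node(3) unfolding Q_def by metis

lemma Q_state: "r \<in> R \<Longrightarrow> Q r \<in> min_states A L"
proof -
  assume r: "r \<in> R"
  have "node r \<in> lists A" using node(1)[OF r] F_lists by (simp add: P_def)
  then show ?thesis using Q_nonempty[OF r] unfolding Q_def min_states_def by blast
qed

lemma fold_\<psi>: "z \<in> lists A \<Longrightarrow> fold g (\<psi> z) = fold g z"
  using act_u by (induction z) auto

text \<open>As \<open>node r\<close> is a suffix of \<open>s\<close>, the word
  \<open>node r @ \<psi> z\<close> stays in \<open>F\<close> and can be parsed, so the transition is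
  defined. It ends in \<open>s\<close>, which determines the state.\<close>

lemma lquot_\<psi>_Q:
  assumes r: "r \<in> R" and z: "z \<in> lists A" and sz: "suffix s (\<psi> z)"
  shows "lquot (\<psi> z) (Q r) = Q (fold g z r)"
proof -
  obtain t where "s = t @ node r" using node(2)[OF r] by (auto simp: suffix_def)
  then have "sublist (node r @ \<psi> z) (s @ \<psi> z)" unfolding sublist_def by (metis append.assoc append_Nil2)
  then have "node r @ \<psi> z \<in> F" using z unfolding factors_def by blast
  then obtain y p where "y \<in> L" "p \<in> P" "node r @ \<psi> z = y @ p" using F_decomp by blast
  then have ne: "lquot (node r @ \<psi> z) L \<noteq> {}" using lquot_append_star lquot_P_nonempty by simp
  obtain t' where t': "\<psi> z = t' @ s" using sz by (auto simp: suffix_def)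
  have "lquot (node r @ \<psi> z) L = Q (fold g (node r @ \<psi> z) r0)"
    using lquot_ending_s[of "node r @ t'"] ne unfolding t' by simp
  then show ?thesis unfolding Q_def lquot_lquot using node(3)[OF r] fold_\<psi>[OF z] by simp
qed

text \<open>A power of one letter suffices: the exponent is a multiple of a period of
  \<open>g a\<close> and makes \<open>\<psi> z\<close> at least as long as \<open>s\<close>, which
  is a suffix of \<open>s @ \<psi> z\<close>.\<close>

lemma exists_idempotent_word:
  obtains z where "z \<in> lists A" "suffix s (\<psi> z)" "fold g z = id"
proof (cases "A = {}")
  case True
  then have "s = []" using s_lists by auto
  then show ?thesis using that[of "[]"] by auto
next
  case False
  then obtain a where a: "a \<in> A" by blast
  obtain n where n: "n > 0" "g a ^^ n = id"
    using permutes_power_id[OF finite_R perm[OF a]] by blast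
  define z where "z = replicate (n * length s) a"
  have "fold g (replicate m a) = g a ^^ m" for m
    by (induction m) (auto simp: funpow_swap1 fun_eq_iff)
  then have "fold g z = (g a ^^ n) ^^ length s" by (simp add: z_def funpow_mult mult.commute)
  then have "fold g z = id" using n(2) by simp
  moreover have "suffix s (\<psi> z)"
  proof -
    have "length w \<le> length (\<psi> w)" for w
    proof (induction w)
      case (Cons b w)
      then show ?case using standard_pair_hd[OF pair, of b] by auto
    qed simp
    moreover have "length s \<le> length z" using n(1) by (simp add: z_def)
    ultimately have "length s \<le> length (\<psi> z)" using le_trans by blast
    moreover have "suffix (\<psi> z) (s @ \<psi> z)" by (simp add: suffixI)
    ultimately show ?thesis
      using suffix_length_suffix[OF standard_pair_suffix[OF pair]] by blast
  qed
  moreover have "z \<in> lists A" using a by (auto simp: z_def)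
  ultimately show ?thesis using that by blast
qed

lemma exists_syntactic_group:
  "\<exists>I P'. syntactic_group A X I P' \<and> perm_equiv R (fold g ` lists A) I P'"
proof -
  obtain z0 where z0: "z0 \<in> lists A" "suffix s (\<psi> z0)" "fold g z0 = id"
    using exists_idempotent_word .
  define G where "G = fold g ` lists A"
  let ?T = "trans_map A L" and ?e = "\<psi> z0"
  define D where "D = {q \<in> min_states A L. lquot ?e q \<noteq> {}}"
  \<comment> \<open>Candidates for the group elements, all with domain \<open>D\<close>:
    \<open>\<gamma>\<close> acts on types, and states in \<open>D\<close> of equal type are
    merged.\<close>
  define h where "h = (\<lambda>\<gamma> q. if q \<in> D then Some (Q (\<gamma> (state_type q))) else None)"
  have e_lists: "?e \<in> lists A" using concat_map_u_lists[OF z0(1)] .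
  have G_perm: "\<gamma> permutes R" if "\<gamma> \<in> G" for \<gamma> using that act_permutes by (auto simp: G_def)
  have G_R: "\<gamma> r \<in> R" if "\<gamma> \<in> G" "r \<in> R" for \<gamma> r
    using G_perm[OF that(1)] that(2) by (simp add: permutes_in_image)
  have idG: "id \<in> G" unfolding G_def by (rule image_eqI[of _ _ "[]"]) (auto simp: id_def)
  have compG: "\<delta> \<circ> \<gamma> \<in> G" if in_G: "\<gamma> \<in> G" "\<delta> \<in> G" for \<gamma> \<delta>
  proof -
    obtain w v where "w \<in> lists A" "v \<in> lists A" "\<gamma> = fold g w" "\<delta> = fold g v"
      using in_G by (auto simp: G_def)
    then have "w @ v \<in> lists A" "\<delta> \<circ> \<gamma> = fold g (w @ v)" by (auto simp: fun_eq_iff)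
    then show ?thesis unfolding G_def by blast
  qed
  have state: "state_type q \<in> R" "lquot ?e q = Q (state_type q)" if q: "q \<in> D" for q
  proof -
    obtain w where w: "w \<in> lists A" "q = lquot w L" "q \<noteq> {}"
      using q by (auto simp: D_def min_states_def)
    have tq: "state_type q = fold g w r0" using state_type_lquot w by metis
    then show "state_type q \<in> R" using act_in_R[OF w(1) r0] by simp
    obtain t where t: "?e = t @ s" using z0(2) by (auto simp: suffix_def)
    have "lquot (w @ ?e) L \<noteq> {}" using q w(2) by (simp add: D_def lquot_lquot)
    then have "lquot (w @ ?e) L = Q (fold g (w @ ?e) r0)"
      using lquot_ending_s[of "w @ t"] unfolding t by simp
    then show "lquot ?e q = Q (state_type q)"
      using w(2) tq fold_\<psi>[OF z0(1)] z0(3) by (simp add: lquot_lquot)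
  qed
  have QD: "Q r \<in> D" if "r \<in> R" for r
    using lquot_\<psi>_Q[OF that z0(1,2)] Q_state[OF that] Q_nonempty[OF that] z0(3)
    by (simp add: D_def)
  have Te: "?T ?e = h id"
    using state(2) by (auto simp: trans_map_def h_def D_def fun_eq_iff)
  \<comment> \<open>The leading \<open>?e\<close> sends \<open>D\<close> into the states
    \<open>Q r\<close>; the trailing \<open>z0\<close> acts trivially and makes the word end in
    \<open>s\<close>, as \<open>lquot_\<psi>_Q\<close> requires.\<close>
  have Th: "?T (?e @ \<psi> (z @ z0)) = h (fold g z)" if z: "z \<in> lists A" for z
  proof -
    have zz: "z @ z0 \<in> lists A" "suffix s (\<psi> (z @ z0))" using z z0 suffix_append by auto
    have "?T (\<psi> (z @ z0)) (Q r) = Some (Q (fold g z r))" if r: "r \<in> R" for r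
      using lquot_\<psi>_Q[OF r zz] Q_state[OF r] Q_nonempty[OF act_in_R[OF z r]] z0(3)
      by (simp add: trans_map_def)
    then show ?thesis
      using state(1) unfolding trans_map_append[OF e_lists] Te
      by (auto simp: pmult_def map_comp_def h_def fun_eq_iff)
  qed
  have h_Q: "h \<gamma> (Q r) = Some (Q (\<gamma> r))" if "r \<in> R" for \<gamma> r
    using QD[OF that] state_type_Q[OF that] by (simp add: h_def)
  \<comment> \<open>\<open>pmult\<close> applies its left argument first, hence the reversed
    order.\<close>
  have h_mult: "pmult (h \<gamma>) (h \<delta>) = h (\<delta> \<circ> \<gamma>)" if "\<gamma> \<in> G" for \<gamma> \<delta>
    using h_Q[OF G_R[OF that state(1)]] by (auto simp: pmult_def map_comp_def h_def fun_eq_iff)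
  have h_monoid: "h \<gamma> \<in> trans_monoid A L" if \<gamma>: "\<gamma> \<in> G" for \<gamma>
  proof -
    obtain z where z: "z \<in> lists A" "\<gamma> = fold g z" using \<gamma> by (auto simp: G_def)
    then have "?e @ \<psi> (z @ z0) \<in> lists A"
      using e_lists concat_map_u_lists[of "z @ z0"] z0(1) by simp
    then show ?thesis using Th[OF z(1)] z(2) unfolding trans_monoid_def by (metis (mono_tags, lifting) mem_Collect_eq)
  qed
  have invG: "\<exists>\<delta>\<in>G. \<delta> \<circ> \<gamma> = id \<and> \<gamma> \<circ> \<delta> = id" if \<gamma>: "\<gamma> \<in> G" for \<gamma>
  proof -
    obtain n where n: "n > 0" "\<gamma> ^^ n = id" using permutes_power_id[OF finite_R G_perm[OF \<gamma>]] .
    have "\<gamma> ^^ m \<in> G" for m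
    proof (induction m)
      case 0
      show ?case unfolding funpow.simps(1) by (rule idG)
    next
      case (Suc m)
      show ?case unfolding funpow.simps(2) by (rule compG[OF Suc \<gamma>])
    qed
    moreover have "\<gamma> ^^ (n - 1) \<circ> \<gamma> = id" "\<gamma> \<circ> \<gamma> ^^ (n - 1) = id"
      using n funpow_Suc_right[of "n - 1" \<gamma>] funpow.simps(2)[of "n - 1" \<gamma>] by simp_all
    ultimately show ?thesis by blast
  qed
  have grp: "group_in (trans_monoid A L) (h ` G)"
    unfolding group_in_def
  proof (intro conjI bexI[of _ "h id"])
    show "\<forall>x\<in>h ` G. \<forall>y\<in>h ` G. pmult x y \<in> h ` G" using h_mult compG by auto
    show "\<forall>x\<in>h ` G. pmult (h id) x = x \<and> pmult x (h id) = x" using h_mult idG by auto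
    show "\<forall>x\<in>h ` G. \<exists>y\<in>h ` G. pmult x y = h id \<and> pmult y x = h id"
    proof
      fix x assume "x \<in> h ` G"
      then obtain \<gamma> where \<gamma>: "\<gamma> \<in> G" "x = h \<gamma>" by blast
      obtain \<delta> where "\<delta> \<in> G" "\<delta> \<circ> \<gamma> = id" "\<gamma> \<circ> \<delta> = id" using invG[OF \<gamma>(1)] by blast
      then show "\<exists>y\<in>h ` G. pmult x y = h id \<and> pmult y x = h id"
        using \<gamma> h_mult by (intro bexI[of _ "h \<delta>"]) auto
    qed
  qed (use h_monoid idG in auto)
  have "max_group_in (trans_monoid A L) (h ` G)"
    unfolding max_group_in_def
  proof (intro conjI grp allI impI)
    fix H' assume H': "group_in (trans_monoid A L) H' \<and> h ` G \<subseteq> H'"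
    then obtain e' where e': "e' \<in> H'" "\<And>x. x \<in> H' \<Longrightarrow> pmult e' x = x \<and> pmult x e' = x"
      "\<And>x. x \<in> H' \<Longrightarrow> \<exists>y\<in>H'. pmult x y = e' \<and> pmult y x = e'"
      unfolding group_in_def by blast
    have hid: "h id \<in> H'" using H' idG by blast
    have assoc: "pmult (pmult x y) z = pmult x (pmult y z)" for x y z :: "'a list set \<Rightarrow> 'a list set option"
      by (auto simp: pmult_def map_comp_def fun_eq_iff split: option.splits)
    \<comment> \<open>The idempotent \<open>h id\<close> lies in the group \<open>H'\<close>, so it
      is the identity \<open>e'\<close>.\<close>
    obtain y where y: "y \<in> H'" "pmult y (h id) = e'" using e'(3)[OF hid] by blast
    have "e' = pmult y (pmult (h id) (h id))" using h_mult[OF idG, of id] y(2) by simp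
    also have "\<dots> = pmult e' (h id)" using y(2) assoc by metis
    finally have e'_eq: "e' = h id" using e'(2)[OF hid] by simp
    \<comment> \<open>Invertibility in \<open>H'\<close> makes \<open>x\<close> defined on each
      \<open>Q r\<close>, and multiplying by \<open>h id\<close> on the right puts its values among
      the states \<open>Q t\<close>. Their types show that \<open>x\<close> acts there as
      \<open>fold g w\<close>.\<close>
    have "x \<in> h ` G" if x: "x \<in> H'" for x
    proof -
      obtain w where w: "w \<in> lists A" "x = ?T w"
        using x H' unfolding group_in_def trans_monoid_def by blast
      obtain x' where x': "pmult x x' = h id" using e'(3)[OF x] e'_eq by blast
      have xQ: "x (Q r) = Some (Q (fold g w r))" if r: "r \<in> R" for r
      proof -
        have "x (Q r) \<noteq> None"
          using fun_cong[OF x', of "Q r"] h_Q[OF r, of id]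
          by (auto simp: pmult_def map_comp_def split: option.splits)
        then have some: "x (Q r) = Some (lquot w (Q r))" "lquot w (Q r) \<noteq> {}"
          using w(2) by (auto simp: trans_map_def split: if_splits)
        have "pmult x (h id) (Q r) = x (Q r)" using e'(2)[OF x] e'_eq by simp
        then have "h id (lquot w (Q r)) = Some (lquot w (Q r))"
          using some by (simp add: pmult_def map_comp_def)
        then have "lquot w (Q r) = Q (state_type (lquot w (Q r)))"
          by (auto simp: h_def split: if_splits)
        also have "state_type (lquot w (Q r)) = fold g w r"
          using state_type_lquot[of "node r @ w"] some(2) node(3)[OF r]
          by (simp add: Q_def lquot_lquot)
        finally show ?thesis using some by simp
      qed
      have "x = pmult (h id) x" using e'(2)[OF x] e'_eq by simp
      also have "\<dots> = h (fold g w)"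
        using xQ state(1) by (auto simp: pmult_def map_comp_def h_def fun_eq_iff)
      finally show ?thesis using w(1) unfolding G_def by blast
    qed
    then show "H' = h ` G" using H' by blast
  qed
  then have "syntactic_group A X (canon_dom (h ` G)) (canon_perms (h ` G))"
    unfolding syntactic_group_def by blast
  moreover have dom: "canon_dom (h ` G) = Q ` R"
  proof (intro equalityI subsetI)
    fix q assume "q \<in> canon_dom (h ` G)"
    then obtain \<gamma> q' where "\<gamma> \<in> G" "h \<gamma> q' = Some q" by (auto simp: canon_dom_def ran_def)
    then show "q \<in> Q ` R" using G_R state(1) by (auto simp: h_def split: if_splits)
  next
    fix q assume "q \<in> Q ` R"
    then obtain r where "r \<in> R" "q = Q r" by blast
    then have "h id (Q r) = Some q" using h_Q by simp
    then show "q \<in> canon_dom (h ` G)" using idG unfolding canon_dom_def by (auto intro: ranI)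
  qed
  moreover have "perm_equiv R G (Q ` R) (canon_perms (h ` G))"
  proof -
    define \<sigma> where "\<sigma> = (\<lambda>\<gamma> q. if q \<in> Q ` R then the (h \<gamma> q) else q)"
    have \<sigma>_Q: "\<sigma> \<gamma> (Q r) = Q (\<gamma> r)" if "r \<in> R" for \<gamma> r
      using h_Q[OF that] that by (simp add: \<sigma>_def)
    have Q_inj: "inj_on Q R" using state_type_Q by (metis inj_onI)
    have \<sigma>_inj: "inj_on \<sigma> G"
    proof (rule inj_onI)
      fix \<gamma> \<delta> assume \<gamma>\<delta>: "\<gamma> \<in> G" "\<delta> \<in> G" "\<sigma> \<gamma> = \<sigma> \<delta>"
      show "\<gamma> = \<delta>"
      proof
        fix r show "\<gamma> r = \<delta> r"
        proof (cases "r \<in> R")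
          case True
          then have "Q (\<gamma> r) = Q (\<delta> r)" using \<sigma>_Q \<gamma>\<delta>(3) by metis
          then show ?thesis using Q_inj G_R \<gamma>\<delta>(1,2) True by (meson inj_onD)
        next
          case False
          then show ?thesis using permutes_not_in[OF G_perm[OF \<gamma>\<delta>(1)]] permutes_not_in[OF G_perm[OF \<gamma>\<delta>(2)]] by simp
        qed
      qed
    qed
    have \<sigma>_comp: "\<sigma> (\<gamma> \<circ> \<delta>) = \<sigma> \<gamma> \<circ> \<sigma> \<delta>" if "\<delta> \<in> G" for \<gamma> \<delta>
    proof
      fix q show "\<sigma> (\<gamma> \<circ> \<delta>) q = (\<sigma> \<gamma> \<circ> \<sigma> \<delta>) q"
      proof (cases "q \<in> Q ` R")
        case True
        then show ?thesis using \<sigma>_Q G_R[OF that] by auto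
      next
        case False
        then show ?thesis by (simp add: \<sigma>_def)
      qed
    qed
    have "canon_perms (h ` G) = \<sigma> ` G"
      by (simp add: canon_perms_def dom \<sigma>_def image_image)
    then have "bij_betw \<sigma> G (canon_perms (h ` G))" using \<sigma>_inj by (simp add: bij_betw_def)
    then show ?thesis unfolding perm_equiv_def
      using Q_inj \<sigma>_comp \<sigma>_Q by (intro exI[of _ Q] exI[of _ \<sigma>]) (auto simp: bij_betw_def)
  qed
  ultimately show ?thesis unfolding G_def by metis
qed

end

section \<open>Generated permutation groups and the conclusion\<close>

lemma perm_gen_eq_fold:
  assumes "finite R" "\<And>a. a \<in> A \<Longrightarrow> g a permutes R"
  shows "perm_gen (g ` A) = fold g ` lists A"
proof (intro equalityI subsetI)
  fix h assume "h \<in> perm_gen (g ` A)"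
  then show "h \<in> fold g ` lists A"
  proof induction
    case gen_id
    show ?case by (rule image_eqI[of _ _ "[]"]) (auto simp: id_def)
  next
    case (gen_base h)
    then obtain a where "a \<in> A" "h = g a" by blast
    then show ?case by (intro image_eqI[of _ _ "[a]"]) auto
  next
    case (gen_comp h h')
    then obtain w v where "w \<in> lists A" "v \<in> lists A" "h = fold g w" "h' = fold g v" by blast
    then show ?case by (intro image_eqI[of _ _ "v @ w"]) (auto simp: fun_eq_iff)
  next
    case (gen_inv h)
    then obtain w where w: "w \<in> lists A" "h = fold g w" by blast
    have h: "h permutes R" unfolding w(2) by (rule fold_permutes[of A, OF assms(2) w(1)])
    \<comment> \<open>On a finite set the inverse is a power, so words in the generators alone
      suffice.\<close>
    obtain n where n: "n > 0" "h ^^ n = id" using permutes_power_id[OF assms(1) h] .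
    have "h \<circ> h ^^ (n - 1) = id" using n funpow.simps(2)[of "n - 1" h] by simp
    then have "inv h = h ^^ (n - 1)"
      using permutes_inv_o(2)[OF h] by (metis comp_assoc comp_id id_comp)
    then have "inv h = fold g (concat (replicate (n - 1) w))"
      by (simp add: fold_concat_replicate w(2))
    moreover have "concat (replicate (n - 1) w) \<in> lists A" using w(1) by auto
    ultimately show ?case by blast
  qed
next
  fix h assume "h \<in> fold g ` lists A"
  then obtain w where "w \<in> lists A" "h = fold g w" by blast
  moreover have "fold g w \<in> perm_gen (g ` A)" if "w \<in> lists A" for w
    using that
  proof (induction w)
    case Nil
    have "fold g [] = id" by auto
    then show ?case using perm_gen.gen_id by metis
  next
    case (Cons a w)
    have "g a \<in> perm_gen (g ` A)" using Cons.hyps(1) by (intro perm_gen.gen_base imageI)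
    then have "fold g w \<circ> g a \<in> perm_gen (g ` A)" by (rule perm_gen.gen_comp[OF Cons.IH])
    moreover have "fold g (a # w) = fold g w \<circ> g a" by auto
    ultimately show ?case by metis
  qed
  ultimately show "h \<in> perm_gen (g ` A)" by blast
qed

theorem mainTheorem20:
  fixes R :: "'r set" and G :: "('r \<Rightarrow> 'r) set" and d k :: nat
  assumes "finite R" and "R \<noteq> {}" and "card R = d"
    and "perm_group R G" and "transitive_on R G"
    and "\<exists>gs. length gs = k \<and> set gs \<subseteq> G \<and> G = perm_gen (set gs)"
  shows "\<exists>(A :: nat set) X. finite A \<and> card A = k \<and>
           X \<subseteq> lists A - {[]} \<and> finite X \<and> bifix_code X \<and>
           int (card X) = (int k - 1) * int d + 1 \<and>
           (\<exists>I P. syntactic_group A X I P \<and> perm_equiv R G I P)"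
proof -
  obtain gs where gs: "length gs = k" "set gs \<subseteq> G" "G = perm_gen (set gs)"
    using assms(6) by blast
  obtain r0 where r0: "r0 \<in> R" using assms(2) by blast
  \<comment> \<open>Letters are indices into \<open>gs\<close>, so there are exactly
    \<open>k\<close> of them even if generators repeat.\<close>
  define A where "A = {..<k}"
  define g where "g = (!) gs"
  have gA: "g ` A = set gs" unfolding A_def g_def gs(1)[symmetric] by (auto simp: set_conv_nth)
  have perm: "g a permutes R" if "a \<in> A" for a
    using that gA gs(2) assms(4) unfolding perm_group_def by blast
  have G: "G = fold g ` lists A"
    using perm_gen_eq_fold[OF assms(1), of A g] perm gs(3) gA by simp
  have trans: "\<exists>w\<in>lists A. fold g w r = t" if "r \<in> R" "t \<in> R" for r t
    using assms(5) that unfolding transitive_on_def G by blast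
  obtain s u where su: "standard_pair A s u" "\<And>b. b \<in> A \<Longrightarrow> fold g (u b) = g b"
    "\<And>r. r \<in> R \<Longrightarrow> R \<subseteq> visits g s r"
    using exists_visiting_pair[of A R g] assms(1) perm trans unfolding A_def by blast
  interpret return_code A g R r0 s u
  proof
    show "r0 \<in> visits g s r" if "r \<in> R" for r using su(3)[OF that] r0 by blast
  qed (use assms(1) r0 perm su in \<open>auto simp: A_def\<close>)
  have "X \<subseteq> lists A - {[]}" using X_return(1,2) by blast
  moreover have "finite A" "card A = k" by (simp_all add: A_def)
  moreover have "int (card X) = (int k - 1) * int d + 1"
    using card_X assms(3) \<open>card A = k\<close> by simp
  ultimately show ?thesis using finite_X bifix_X exists_syntactic_group G by blast
qed

end
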